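(* Let $G$ be a finite simple graph with vertex set $[n]=\{1,\dots,n\}$ and let $\boldsymbol{p}=(p_1,\dots,p_n)\in[0,1)^n$. Then $\boldsymbol{p}\in\mathcal{S}(G)$ if and only if $\boldsymbol{p}$ is valid for $\mathcal{B}(G)$, the set of self-bounding walks on $G$.
   Context: $\Gamma_i$ denotes the set of neighbors of vertex $i$ in $G$. Avoidance probability and $\mathcal{S}(G)$: Let $\mu$ be a probability measure and $F_1,\dots,F_n$ events with $\mu(F_i)=p_i$. $G$ is a dependency graph for $F_1,\dots,F_n$ with respect to $\mu$ if for every $i\in[n]$ and every $\{j_1,j_2,\dots\}\subseteq[n]\setminus(\Gamma_i\cup\{i\})$ we have $\mu(F_i\mid \overline{F_{j_1}}\cap\overline{F_{j_2}}\cap\cdots)=p_i$ (whenever the conditioning event has positive probability). $\mathrm{avoid}(\boldsymbol{p},G)$ is the smallest possible value of $\mu(\overline{F_1}\cap\cdots\cap\overline{F_n})$ over all probability spaces and events with $\mu(F_i)=p_i$ for all $i$ for which $G$ is a dependency graph. $\mathcal{S}(G)=\{\boldsymbol{p}\in[0,1)^n:\mathrm{avoid}(\boldsymbol{p},G)>0\}$. Walks: A walk on $G$ is a nonempty finite string of vertices in which every two successive characters are adjacent in $G$. A single vertex is a walk. For a walk $w$, $\mathrm{t}(w)$ denotes its last vertex. For a set of walks $\mathcal{W}$ and $w\in\mathcal{W}$, $\mathrm{Ext}(w)$ is the set of walks in $\mathcal{W}$ that extend $w$ by one vertex at its end. Self-bounding walks: a walk is self-bounding if, starting with the set of forbidden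 vertices consisting of just its starting vertex, in each step the walk (i) proceeds from the current vertex $i$ to a vertex $j\in\Gamma_i$ that is not currently forbidden, and (ii) adds to the set of forbidden vertices all neighbors of $i$ that are greater than or equal to $j$ (in the usual order on $[n]$). Forbidden vertices remain forbidden. $\mathcal{B}(G)$ is the set of self-bounding walks on $G$ (including single-vertex walks). Validity: $\boldsymbol{p}\in[0,1)^n$ is valid for a set of walks $\mathcal{W}$ if there exists $L:\mathcal{W}\to[0,1)$ such that for all $w\in\mathcal{W}$, $p_{\mathrm{t}(w)}\le L(w)\prod_{y\in\mathrm{Ext}(w)}(1-L(y))$ (an empty product equals 1). *)

theory Defs
  imports "HOL-Probability.Probability" "Graph_Theory.Graph_Theory"
begin

text \<open>Finite simple graphs are the \<open>pair_graph\<close>s of \<open>Graph_Theory\<close>: the edge \<open>{i, j}\<close> is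
  represented by the two arcs \<open>(i, j)\<close> and \<open>(j, i)\<close>.\<close>

definition neighbors :: "'v pair_pre_digraph \<Rightarrow> 'v \<Rightarrow> 'v set" where
  "neighbors G i = {j. (i, j) \<in> parcs G}"

subsection \<open>Avoidance probability\<close>

definition dependency_graph ::
    "'v pair_pre_digraph \<Rightarrow> 'a measure \<Rightarrow> ('v \<Rightarrow> 'a set) \<Rightarrow> bool" where
  "dependency_graph G M F \<longleftrightarrow>
     (\<forall>i\<in>pverts G. \<forall>J. J \<subseteq> pverts G - (neighbors G i \<union> {i}) \<longrightarrow>
        \<P>(x in M. \<forall>j\<in>J. x \<notin> F j) > 0 \<longrightarrow>
        \<P>(x in M. x \<in> F i \<bar> \<forall>j\<in>J. x \<notin> F j) = measure M (F i))"

definition realizes ::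
    "'a measure \<Rightarrow> ('v \<Rightarrow> 'a set) \<Rightarrow> ('v \<Rightarrow> real) \<Rightarrow> 'v pair_pre_digraph \<Rightarrow> bool" where
  "realizes M F p G \<longleftrightarrow> prob_space M \<and>
     (\<forall>i\<in>pverts G. F i \<in> sets M \<and> measure M (F i) = p i) \<and> dependency_graph G M F"

text \<open>A definition cannot quantify over all types of sample points, so the sample points are fixed
  to be sets of vertices. This loses nothing: only the set of events that occur at a sample point
  matters; see \<open>realizes_canonical\<close> and \<open>avoid_le\<close> below. The infimum is a minimum, since for a
  finite graph the realizing distributions on subsets of \<open>pverts G\<close> form a compact set: each
  constraint amounts to an equation \<open>\<mu>(F i \<inter> C) = p i * \<mu>(C)\<close>.\<close>

definition avoid :: "('v \<Rightarrow> real) \<Rightarrow> 'v pair_pre_digraph \<Rightarrow> real" where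
  "avoid p G = Inf {\<P>(x in M. \<forall>i\<in>pverts G. x \<notin> F i) |
     (M :: 'v set measure) (F :: 'v \<Rightarrow> 'v set set). realizes M F p G}"

text \<open>Vectors indexed by the vertices are functions whose values outside \<open>pverts G\<close> are
  irrelevant.\<close>

definition avoid_region :: "'v pair_pre_digraph \<Rightarrow> ('v \<Rightarrow> real) set" where
  "avoid_region G = {p \<in> pverts G \<rightarrow> {0..<1}. avoid p G > 0}"

lemma realizes_canonical:
  fixes M :: "'a measure" and F :: "'v \<Rightarrow> 'a set"
  assumes fin: "finite (pverts G)" and r: "realizes M F p G"
  shows "\<exists>(N :: 'v set measure) H. realizes N H p G \<and>
    \<P>(x in N. \<forall>i\<in>pverts G. x \<notin> H i) = \<P>(x in M. \<forall>i\<in>pverts G. x \<notin> F i)"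
proof -
  define V where "V = pverts G"
  define f where "f x = {i \<in> V. x \<in> F i}" for x
  define N where "N = distr M (count_space (Pow V)) f"
  define H where "H i = {S \<in> Pow V. i \<in> S}" for i
  have finV: "finite V" using fin by (simp add: V_def)
  interpret prob_space M using r by (simp add: realizes_def)
  have FM: "F i \<in> sets M" if "i \<in> V" for i
    using r that by (simp add: realizes_def V_def)
  have f: "f \<in> measurable M (count_space (Pow V))"
  proof (subst measurable_count_space_eq2, simp add: finV, intro conjI ballI)
    show "f \<in> space M \<rightarrow> Pow V" by (auto simp: f_def)
    fix S assume S: "S \<in> Pow V"
    have "f -` {S} \<inter> space M = {x \<in> space M. \<forall>i\<in>V. x \<in> F i \<longleftrightarrow> i \<in> S}"
    proof -
      have "f x = S \<longleftrightarrow> (\<forall>i\<in>V. x \<in> F i \<longleftrightarrow> i \<in> S)" for x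
        using S unfolding f_def by blast
      then show ?thesis by blast
    qed
    also have "\<dots> \<in> sets M"
    proof (rule sets.sets_Collect_finite_All[OF _ finV])
      fix i assume "i \<in> V"
      then have F: "F i \<in> sets M" by (rule FM)
      have "{x \<in> space M. x \<in> F i} = F i" using sets.sets_into_space[OF F] by blast
      with F have "{x \<in> space M. x \<in> F i} \<in> sets M" by (simp only:)
      then show "{x \<in> space M. (x \<in> F i) = (i \<in> S)} \<in> sets M"
        by (cases "i \<in> S") (auto intro: sets.sets_Collect_neg)
    qed
    finally show "f -` {S} \<inter> space M \<in> sets M" .
  qed
  have spN: "space N = Pow V" by (simp add: N_def)
  have mN: "\<P>(x in N. Q x) = \<P>(x in M. Q (f x))" for Q
  proof -
    have "\<P>(x in N. Q x) = measure M (f -` {x \<in> Pow V. Q x} \<inter> space M)"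
      unfolding spN unfolding N_def by (rule measure_distr[OF f]) auto
    also have "f -` {x \<in> Pow V. Q x} \<inter> space M = {x \<in> space M. Q (f x)}"
      by (auto simp: f_def)
    finally show ?thesis .
  qed
  have Hf: "f x \<in> H i \<longleftrightarrow> x \<in> F i" if "i \<in> V" for x i
    using that by (auto simp: f_def H_def)
  have cN: "\<P>(x in N. Q x \<bar> R x) = \<P>(x in M. Q (f x) \<bar> R (f x))" for Q R
    by (simp add: cond_prob_def mN)
  have mH: "measure N (H i) = measure M (F i)" if "i \<in> V" for i
  proof -
    have "measure N (H i) = \<P>(x in N. x \<in> H i)"
      by (rule arg_cong[where f = "measure N"]) (auto simp: spN H_def)
    also have "\<dots> = \<P>(x in M. x \<in> F i)" using that by (simp add: mN Hf)
    also have "{x \<in> space M. x \<in> F i} = F i"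
      using sets.sets_into_space[OF FM[OF that]] by auto
    finally show ?thesis .
  qed
  have all: "(\<forall>j\<in>J. f x \<notin> H j) \<longleftrightarrow> (\<forall>j\<in>J. x \<notin> F j)" if "J \<subseteq> V" for J x
    using that Hf by blast
  have "dependency_graph G N H"
    unfolding dependency_graph_def
  proof (intro ballI allI impI)
    fix i J assume i: "i \<in> pverts G" and J: "J \<subseteq> pverts G - (neighbors G i \<union> {i})"
      and pos: "0 < \<P>(x in N. \<forall>j\<in>J. x \<notin> H j)"
    have JV: "J \<subseteq> V" using J by (auto simp: V_def)
    have iV: "i \<in> V" using i by (simp add: V_def)
    have "0 < \<P>(x in M. \<forall>j\<in>J. x \<notin> F j)" using pos by (simp add: mN all[OF JV])
    with r i J have "\<P>(x in M. x \<in> F i \<bar> \<forall>j\<in>J. x \<notin> F j) = measure M (F i)"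
      unfolding realizes_def dependency_graph_def by blast
    then show "\<P>(x in N. x \<in> H i \<bar> \<forall>j\<in>J. x \<notin> H j) = measure N (H i)"
      by (simp add: cN all[OF JV] Hf[OF iV] mH[OF iV])
  qed
  moreover have "prob_space N" unfolding N_def by (rule prob_space_distr[OF f])
  moreover have "H i \<in> sets N" for i by (auto simp: N_def H_def)
  ultimately have "realizes N H p G"
    using r mH by (simp add: realizes_def V_def)
  moreover have "\<P>(x in N. \<forall>i\<in>pverts G. x \<notin> H i) = \<P>(x in M. \<forall>i\<in>pverts G. x \<notin> F i)"
    using all[of V] by (simp add: mN V_def)
  ultimately show ?thesis by (intro exI conjI)
qed

lemma avoid_le:
  fixes M :: "'a measure" and F :: "'v \<Rightarrow> 'a set"
  assumes "finite (pverts G)" and "realizes M F p G"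
  shows "avoid p G \<le> \<P>(x in M. \<forall>i\<in>pverts G. x \<notin> F i)"
proof -
  obtain N :: "'v set measure" and H where N: "realizes N H p G"
    and eq: "\<P>(x in N. \<forall>i\<in>pverts G. x \<notin> H i) = \<P>(x in M. \<forall>i\<in>pverts G. x \<notin> F i)"
    using realizes_canonical[OF assms] by (elim exE conjE)
  have "avoid p G \<le> \<P>(x in N. \<forall>i\<in>pverts G. x \<notin> H i)"
    unfolding avoid_def
  proof (rule cInf_lower)
    show "\<P>(x in N. \<forall>i\<in>pverts G. x \<notin> H i) \<in> {\<P>(x in M. \<forall>i\<in>pverts G. x \<notin> F i) |
        (M :: 'v set measure) F. realizes M F p G}"
      by (rule CollectI, rule exI[of _ N], rule exI[of _ H], rule conjI[OF refl N])
    show "bdd_below {\<P>(x in M. \<forall>i\<in>pverts G. x \<notin> F i) |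
        (M :: 'v set measure) F. realizes M F p G}"
      by (rule bdd_belowI[of _ 0]) (elim CollectE exE conjE, simp)
  qed
  with eq show ?thesis by simp
qed

subsection \<open>Walks and validity\<close>

definition walks :: "'v pair_pre_digraph \<Rightarrow> 'v list set" where
  "walks G = {w. vwalk w (with_proj G)}"

definition Ext :: "'v list set \<Rightarrow> 'v list \<Rightarrow> 'v list set" where
  "Ext W w = {y \<in> W. \<exists>j. y = w @ [j]}"

definition valid :: "('v \<Rightarrow> real) \<Rightarrow> 'v list set \<Rightarrow> bool" where
  "valid p W \<longleftrightarrow>
     (\<exists>L. L \<in> W \<rightarrow> {0..<1} \<and> (\<forall>w\<in>W. p (last w) \<le> L w * (\<Prod>y\<in>Ext W w. 1 - L y)))"

text \<open>\<open>self_bounding G w B\<close>: the walk \<open>w\<close> can be traversed according to the rules, and \<open>B\<close> is the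
  set of forbidden vertices afterwards.\<close>

inductive self_bounding :: "'v::linorder pair_pre_digraph \<Rightarrow> 'v list \<Rightarrow> 'v set \<Rightarrow> bool"
  for G where
  start: "i \<in> pverts G \<Longrightarrow> self_bounding G [i] {i}"
| step: "self_bounding G w B \<Longrightarrow> j \<in> neighbors G (last w) \<Longrightarrow> j \<notin> B \<Longrightarrow>
    self_bounding G (w @ [j]) (B \<union> {k \<in> neighbors G (last w). k \<ge> j})"

definition self_bounding_walks :: "'v::linorder pair_pre_digraph \<Rightarrow> 'v list set" where
  "self_bounding_walks G = {w \<in> walks G. \<exists>B. self_bounding G w B}"

end

theory Submission
  imports Defs "HOL-Probability.Product_PMF"
begin

text \<open>Write \<open>I(S)\<close> for the independence polynomial of the subgraph induced on \<open>S\<close>, evaluated at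
  \<open>-p\<close>. By Shearer's theorem, \<open>avoid p G > 0\<close> iff \<open>I(S) > 0\<close> for all \<open>S\<close>: if so, \<open>I\<close> bounds
  the avoidance probability from below; if not, \<open>p\<close> is scaled down to \<open>t p\<close> where the least \<open>I(S)\<close>
  vanishes, Shearer's measure for \<open>t p\<close> avoids all events with probability \<open>0\<close>, and the events are
  enlarged to the probabilities \<open>p i\<close> by uniting them with independent ones.

  A self-bounding walk ending in \<open>i\<close> with set \<open>B\<close> of forbidden vertices encodes the ratio
  \<open>I(insert i S) / I(S)\<close> with \<open>S = V - B\<close>, which is \<open>1 - L\<close> for the extremal \<open>L\<close>. The recursion
  \<open>I(insert i S) = I(S) - p i * I(S - \<Gamma> i)\<close>, with the neighbours of \<open>i\<close> removed from \<open>S\<close> one at a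
  time from the largest to the smallest, turns into the validity condition, with equality, because
  the product over the extensions of the walk telescopes to \<open>I(S) / I(S - \<Gamma> i)\<close>.\<close>

definition independent :: "'v pair_pre_digraph \<Rightarrow> 'v set \<Rightarrow> bool" where
  "independent G T \<longleftrightarrow> (\<forall>i\<in>T. \<forall>j\<in>T. (i, j) \<notin> parcs G)"

definition ind_poly :: "'v pair_pre_digraph \<Rightarrow> ('v \<Rightarrow> real) \<Rightarrow> 'v set \<Rightarrow> real" where
  "ind_poly G p S = (\<Sum>T | T \<subseteq> S \<and> independent G T. \<Prod>i\<in>T. - p i)"

subsection \<open>The independence polynomial\<close>

lemma ind_poly_empty [simp]: "ind_poly G p {} = 1"
proof -
  have "{T. T \<subseteq> {} \<and> independent G T} = {{}}" by (auto simp: independent_def)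
  then show ?thesis by (simp add: ind_poly_def)
qed

lemma (in pair_graph) not_self_neighbor: "v \<notin> neighbors G v"
  using pair_no_loops[of "(v, v)"] by (auto simp: neighbors_def)

lemma (in pair_graph) neighbors_subset: "neighbors G v \<subseteq> pverts G"
  using arc_snd_in_verts by (force simp: neighbors_def)

lemma (in pair_graph) independent_insert:
  "independent G (insert v T) \<longleftrightarrow> independent G T \<and> T \<inter> neighbors G v = {}"
proof -
  have sym: "(a, b) \<in> parcs G \<Longrightarrow> (b, a) \<in> parcs G" for a b
    using pair_sym_arcs by (auto simp: symmetric_def sym_def)
  show ?thesis
    using not_self_neighbor[of v] sym by (auto simp: independent_def neighbors_def)
qed

text \<open>Independent subsets of \<open>insert v S\<close> either avoid \<open>v\<close> or have
  the form \<open>insert v T\<close>, where \<open>T\<close> also avoids the neighbours of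
  \<open>v\<close>. The weight \<open>g\<close> is arbitrary because the splitting serves both
  \<open>ind_poly\<close> and the weights of Shearer's measure.\<close>

lemma (in pair_graph) sum_independent_insert:
  fixes g :: "'a set \<Rightarrow> real"
  assumes "finite S" "v \<notin> S"
  shows "(\<Sum>T | T \<subseteq> insert v S \<and> independent G T. g T) =
    (\<Sum>T | T \<subseteq> S \<and> independent G T. g T) +
    (\<Sum>T | T \<subseteq> S - neighbors G v \<and> independent G T. g (insert v T))"
proof -
  let ?A = "{T. T \<subseteq> S \<and> independent G T}"
  let ?B = "{T. T \<subseteq> S - neighbors G v \<and> independent G T}"
  have eq: "{T. T \<subseteq> insert v S \<and> independent G T} = ?A \<union> insert v ` ?B"
  proof (intro equalityI subsetI)
    fix T assume T: "T \<in> {T. T \<subseteq> insert v S \<and> independent G T}"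
    show "T \<in> ?A \<union> insert v ` ?B"
    proof (cases "v \<in> T")
      case True
      then have "T = insert v (T - {v})" by auto
      moreover have "T - {v} \<in> ?B"
        using T True independent_insert[of v "T - {v}"] by (auto simp: insert_absorb)
      ultimately show ?thesis by blast
    next
      case False
      then show ?thesis using T by auto
    qed
  next
    fix T assume "T \<in> ?A \<union> insert v ` ?B"
    then show "T \<in> {T. T \<subseteq> insert v S \<and> independent G T}"
      by (auto simp: independent_insert)
  qed
  have "finite ?A" "finite ?B" using assms(1) by auto
  moreover have "?A \<inter> insert v ` ?B = {}" using assms(2) by auto
  moreover have "inj_on (insert v) ?B" using assms(2) by (auto simp: inj_on_def)
  ultimately show ?thesis
    unfolding eq by (simp add: sum.union_disjoint sum.reindex)
qed

text \<open>The independent sets containing \<open>v\<close> carry an extra factor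
  \<open>- p v\<close>.\<close>

lemma (in pair_graph) ind_poly_insert:
  assumes "finite S" "v \<notin> S"
  shows "ind_poly G p (insert v S) = ind_poly G p S - p v * ind_poly G p (S - neighbors G v)"
proof -
  have "(\<Prod>i\<in>insert v T. - p i) = - p v * (\<Prod>i\<in>T. - p i)" if "T \<subseteq> S - neighbors G v" for T
    using assms that by (subst prod.insert) (auto intro: finite_subset)
  then have "(\<Sum>T | T \<subseteq> S - neighbors G v \<and> independent G T. \<Prod>i\<in>insert v T. - p i) =
    (\<Sum>T | T \<subseteq> S - neighbors G v \<and> independent G T. - p v * (\<Prod>i\<in>T. - p i))"
    by (intro sum.cong) auto
  then show ?thesis
    unfolding ind_poly_def sum_independent_insert[OF assms] by (simp add: sum_distrib_left sum_negf)
qed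

text \<open>By the recurrence, adding a vertex subtracts a nonnegative quantity. At the critical
  scaling this carries a zero of \<open>ind_poly\<close> from a subset to the whole vertex
  set.\<close>

lemma (in pair_graph) ind_poly_antimono:
  assumes "finite S" "T \<subseteq> S" "\<And>i. i \<in> S \<Longrightarrow> 0 \<le> p i"
    and nonneg: "\<And>U. U \<subseteq> S \<Longrightarrow> 0 \<le> ind_poly G p U"
  shows "ind_poly G p S \<le> ind_poly G p T"
proof -
  have "D \<subseteq> S - T \<Longrightarrow> ind_poly G p (T \<union> D) \<le> ind_poly G p T" if "finite D" for D
    using that
  proof (induction D rule: finite_induct)
    case (insert v D)
    have fin: "finite (T \<union> D)" using assms(1,2) insert.hyps finite_subset by auto
    have "ind_poly G p (insert v (T \<union> D)) \<le> ind_poly G p (T \<union> D)"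
      using ind_poly_insert[OF fin, of v p] insert assms
      by (auto intro!: mult_nonneg_nonneg nonneg)
    then show ?case using insert by auto
  qed simp
  from this[of "S - T"] show ?thesis using assms(1,2) by (simp add: Un_absorb1)
qed

subsection \<open>Shearer's lower bound\<close>

lemma none_in_sets:
  assumes "finite J" "\<And>j. j \<in> J \<Longrightarrow> F j \<in> sets M"
  shows "{x \<in> space M. \<forall>j\<in>J. x \<notin> F j} \<in> sets M"
proof -
  have "{x \<in> space M. \<forall>j\<in>J. x \<notin> F j} = space M - (\<Union>j\<in>J. F j)" by auto
  also have "\<dots> \<in> sets M" using assms by (intro sets.compl_sets sets.finite_UN) auto
  finally show ?thesis .
qed

text \<open>Probabilistic counterpart of \<open>ind_poly_insert\<close>: \<open>F i\<close> is
  independent of avoiding the non-neighbours in \<open>J\<close>, and dropping the neighbours from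
  \<open>J\<close> only enlarges the avoidance event, so the equation becomes an inequality.\<close>

lemma realizes_prob_insert_ge:
  assumes "finite (pverts G)" "realizes M F p G" "i \<in> pverts G" "J \<subseteq> pverts G - {i}"
  shows "\<P>(x in M. \<forall>j\<in>insert i J. x \<notin> F j) \<ge>
    \<P>(x in M. \<forall>j\<in>J. x \<notin> F j) - p i * \<P>(x in M. \<forall>j\<in>J - neighbors G i. x \<notin> F j)"
proof -
  interpret prob_space M using assms(2) by (simp add: realizes_def)
  have FM: "F j \<in> sets M" "measure M (F j) = p j" if "j \<in> pverts G" for j
    using assms(2) that by (auto simp: realizes_def)
  let ?K = "J - neighbors G i"
  let ?N = "\<lambda>J. {x \<in> space M. \<forall>j\<in>J. x \<notin> F j}"
  have N: "?N J' \<in> sets M" if "J' \<subseteq> pverts G" for J'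
    using assms(1) that FM(1) by (intro none_in_sets) (auto intro: finite_subset)
  have NJ: "?N J \<in> sets M" and NK: "?N ?K \<in> sets M" using assms(4) by (auto intro!: N)
  have dep: "prob (F i \<inter> ?N ?K) = p i * prob (?N ?K)"
  \<comment> \<open>The dependency condition is silent about null conditioning events, but then both
    sides are 0.\<close>
  proof (cases "prob (?N ?K) = 0")
    case True
    have "prob (F i \<inter> ?N ?K) \<le> prob (?N ?K)" using NK by (intro finite_measure_mono) auto
    then have "prob (F i \<inter> ?N ?K) = 0" using True measure_nonneg[of M "F i \<inter> ?N ?K"] by linarith
    then show ?thesis using True by simp
  next
    case False
    then have "0 < prob (?N ?K)" by (simp add: zero_less_measure_iff)
    moreover have "?K \<subseteq> pverts G - (neighbors G i \<union> {i})" using assms(4) by auto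
    ultimately have "\<P>(x in M. x \<in> F i \<bar> \<forall>j\<in>?K. x \<notin> F j) = prob (F i)"
      using assms(2,3) unfolding realizes_def dependency_graph_def by blast
    then have "\<P>(x in M. x \<in> F i \<bar> \<forall>j\<in>?K. x \<notin> F j) = p i"
      by (simp only: FM(2)[OF assms(3)])
    moreover have "{x \<in> space M. x \<in> F i \<and> (\<forall>j\<in>?K. x \<notin> F j)} = F i \<inter> ?N ?K"
      using sets.sets_into_space[OF FM(1)[OF assms(3)]] by blast
    ultimately show ?thesis using False by (simp add: cond_prob_def divide_eq_eq)
  qed
  have "?N (insert i J) = ?N J - F i \<inter> ?N J" by auto
  then have "prob (?N (insert i J)) = prob (?N J) - prob (F i \<inter> ?N J)"
    using NJ FM(1)[OF assms(3)] by (simp add: finite_measure_Diff)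
  moreover have "prob (F i \<inter> ?N J) \<le> prob (F i \<inter> ?N ?K)"
    using NK FM(1)[OF assms(3)] by (intro finite_measure_mono) auto
  ultimately show ?thesis using dep by simp
qed

lemma (in pair_graph) shearer_lower_bound:
  assumes r: "realizes M F p G" and p: "\<And>i. i \<in> pverts G \<Longrightarrow> 0 \<le> p i"
    and pos: "\<And>S. S \<subseteq> pverts G \<Longrightarrow> 0 < ind_poly G p S"
  shows "ind_poly G p (pverts G) \<le> \<P>(x in M. \<forall>i\<in>pverts G. x \<notin> F i)"
proof -
  interpret M: prob_space M using r by (simp add: realizes_def)
  define Q where "Q J = \<P>(x in M. \<forall>j\<in>J. x \<notin> F j)" for J
  have fin: "finite S" if "S \<subseteq> pverts G" for S
    using that pair_finite_verts by (rule finite_subset)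
  \<comment> \<open>This compares the ratio \<open>Q S / Q T\<close> with that of
    \<open>ind_poly\<close>, cross-multiplied because \<open>Q T\<close> could be 0. All
    \<open>T\<close> are needed: the hypothesis is used at \<open>R - neighbors G i\<close> and at
    \<open>T\<close>.\<close>
  have main: "S \<subseteq> pverts G \<longrightarrow> (\<forall>T\<subseteq>S. ind_poly G p S * Q T \<le> Q S * ind_poly G p T)"
    if "finite S" for S
    using that
  proof (induction S rule: finite_psubset_induct)
    case (psubset S)
    show ?case
    proof (intro impI allI)
      fix T assume S: "S \<subseteq> pverts G" and T: "T \<subseteq> S"
      show "ind_poly G p S * Q T \<le> Q S * ind_poly G p T"
      proof (cases "T = S")
        case False
        then obtain i where i: "i \<in> S" "i \<notin> T" using T by auto
        define R where "R = S - {i}"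
        have R: "insert i R = S" "i \<notin> R" "T \<subseteq> R" "R \<subset> S" "R \<subseteq> pverts G"
          using i T S by (auto simp: R_def)
        have IH: "ind_poly G p R * Q U \<le> Q R * ind_poly G p U" if "U \<subseteq> R" for U
          using psubset.IH[of R] R that by auto
        let ?I = "ind_poly G p"
        have "Q R - p i * Q (R - neighbors G i) \<le> Q S"
          using realizes_prob_insert_ge[OF pair_finite_verts r, of i R] R i S
          by (auto simp: Q_def)
        then have "?I R * (Q R - p i * Q (R - neighbors G i)) \<le> ?I R * Q S"
          using pos[OF R(5)] by (intro mult_left_mono) auto
        \<comment> \<open>\<open>Q (R - neighbors G i)\<close> enters with a minus sign, so the
          hypothesis bounds it from above.\<close>
        moreover have "p i * (?I R * Q (R - neighbors G i)) \<le> p i * (Q R * ?I (R - neighbors G i))"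
          using i S p by (intro mult_left_mono IH) auto
        ultimately have "(?I R - p i * ?I (R - neighbors G i)) * Q R \<le> ?I R * Q S"
          by (simp add: algebra_simps)
        then have "?I S * Q R \<le> ?I R * Q S"
          using ind_poly_insert[OF fin[OF R(5)] R(2), of p] R(1) by simp
        then have "?I T * (?I S * Q R) \<le> ?I T * (?I R * Q S)"
          using pos[OF subset_trans[OF T S]] by (intro mult_left_mono) auto
        moreover have "?I S * (?I R * Q T) \<le> ?I S * (Q R * ?I T)"
          using pos[OF S] R by (intro mult_left_mono IH) auto
        ultimately have "?I R * (?I S * Q T) \<le> ?I R * (Q S * ?I T)"
          by (simp add: algebra_simps)
        then show ?thesis using pos[OF R(5)] by simp
      qed simp
    qed
  qed
  from main[OF pair_finite_verts] have "ind_poly G p (pverts G) * Q {} \<le> Q (pverts G)"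
    by fastforce
  then show ?thesis by (simp add: Q_def M.prob_space)
qed

subsection \<open>Self-bounding walks\<close>

text \<open>The elements of \<open>A\<close> leave \<open>S\<close> from the largest to the
  smallest, and the factor at \<open>j\<close> records the departure of \<open>j\<close>. In the
  induction a new minimum departs last and contributes the final factor.\<close>

lemma prod_telescope:
  fixes f :: "'v::linorder set \<Rightarrow> real"
  assumes "finite A" and "\<And>B. B \<subseteq> A \<Longrightarrow> f (S - B) \<noteq> 0"
  shows "(\<Prod>j\<in>A. f (S - {k\<in>A. k > j}) / f (S - {k\<in>A. k \<ge> j})) = f S / f (S - A)"
  using assms
proof (induction A rule: finite_linorder_min_induct)
  case empty
  then show ?case using empty(1)[of "{}"] by simp
next
  case (insert b A)
  have b: "b \<notin> A" "{k \<in> insert b A. k > b} = A" "{k \<in> insert b A. k \<ge> b} = insert b A"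
    using insert.hyps by auto
  have "(\<Prod>j\<in>A. f (S - {k\<in>insert b A. k > j}) / f (S - {k\<in>insert b A. k \<ge> j})) =
    (\<Prod>j\<in>A. f (S - {k\<in>A. k > j}) / f (S - {k\<in>A. k \<ge> j}))"
  proof (intro prod.cong refl)
    fix j assume "j \<in> A"
    then have "{k\<in>insert b A. k > j} = {k\<in>A. k > j}" "{k\<in>insert b A. k \<ge> j} = {k\<in>A. k \<ge> j}"
      using insert.hyps by force+
    then show "f (S - {k\<in>insert b A. k > j}) / f (S - {k\<in>insert b A. k \<ge> j}) =
      f (S - {k\<in>A. k > j}) / f (S - {k\<in>A. k \<ge> j})" by simp
  qed
  also have "\<dots> = f S / f (S - A)" using insert.prems by (intro insert.IH) auto
  finally show ?case
    using insert.prems[of A] insert.hyps(1) b by (simp add: subset_insertI)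
qed

section \<open>Forbidden sets and extensions of self-bounding walks\<close>

text \<open>A walk determines its moves and hence its forbidden set, so a labelling of walks may be
  defined through that set.\<close>

lemma self_bounding_unique:
  assumes "self_bounding G w B" "self_bounding G w C"
  shows "B = C"
  using assms
proof (induction arbitrary: C rule: self_bounding.induct)
  case (start i)
  from start(2) show ?case
    by (cases rule: self_bounding.cases) (auto elim: self_bounding.cases)
next
  case (step w B j)
  from step.prems show ?case
  proof (cases rule: self_bounding.cases)
    case (start i)
    then have "w = []" by simp
    then show ?thesis using step.hyps(1) by (auto elim: self_bounding.cases)
  next
    case (step w' B' j')
    then show ?thesis using \<open>\<And>C. self_bounding G w C \<Longrightarrow> B = C\<close> by auto
  qed
qed

lemma self_bounding_snoc_iff:
  assumes "self_bounding G w B"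
  shows "(\<exists>C. self_bounding G (w @ [j]) C) \<longleftrightarrow> j \<in> neighbors G (last w) - B"
proof
  assume "\<exists>C. self_bounding G (w @ [j]) C"
  then obtain C where "self_bounding G (w @ [j]) C" ..
  then show "j \<in> neighbors G (last w) - B"
  proof (cases rule: self_bounding.cases)
    case (start i)
    then show ?thesis using assms by (auto elim: self_bounding.cases)
  next
    case (step w' B' j')
    then show ?thesis using self_bounding_unique[OF assms, of B'] by auto
  qed
qed (use assms in \<open>auto intro: self_bounding.step\<close>)

lemma vwalk_arcs_snoc: "w \<noteq> [] \<Longrightarrow> vwalk_arcs (w @ [j]) = vwalk_arcs w @ [(last w, j)]"
  by (induction w rule: vwalk_arcs.induct) auto

lemma self_bounding_props:
  fixes G :: "'v::linorder pair_pre_digraph"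
  assumes "pair_graph G" "self_bounding G w B"
  shows "w \<in> walks G" "last w \<in> B" "B \<subseteq> pverts G"
proof -
  interpret pair_graph G by fact
  \<comment> \<open>The conjunct \<open>w \<noteq> []\<close> strengthens the induction so that
    \<open>vwalk_arcs_snoc\<close> applies.\<close>
  from assms(2) have "w \<in> walks G \<and> last w \<in> B \<and> B \<subseteq> pverts G \<and> w \<noteq> []"
  proof (induction rule: self_bounding.induct)
    case (start i)
    then show ?case by (auto simp: walks_def vwalk_def)
  next
    case (step w B j)
    have "j \<in> pverts G" using step.hyps neighbors_subset by blast
    moreover have "(last w, j) \<in> parcs G" using step.hyps by (simp add: neighbors_def)
    then have "(last w, j) \<in> arcs_ends (with_proj G)"
      by (force simp: arcs_ends_def arc_to_ends_def)
    ultimately show ?case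
      using step neighbors_subset[of "last w"]
      by (auto simp: walks_def vwalk_def vwalk_arcs_snoc)
  qed
  then show "w \<in> walks G" "last w \<in> B" "B \<subseteq> pverts G" by auto
qed

lemma Ext_self_bounding_walks:
  assumes "pair_graph G" "self_bounding G w B"
  shows "Ext (self_bounding_walks G) w = (\<lambda>j. w @ [j]) ` (neighbors G (last w) - B)"
proof -
  have "y \<in> self_bounding_walks G \<longleftrightarrow> (\<exists>C. self_bounding G y C)" for y
    using self_bounding_props[OF assms(1)] by (auto simp: self_bounding_walks_def)
  then show ?thesis
    using self_bounding_snoc_iff[OF assms(2)] by (auto simp: Ext_def)
qed

lemma prod_Ext_self_bounding_walks:
  fixes L :: "'v::linorder list \<Rightarrow> real"
  assumes "pair_graph G" "self_bounding G w B"
  shows "(\<Prod>y\<in>Ext (self_bounding_walks G) w. 1 - L y) =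
    (\<Prod>j\<in>neighbors G (last w) - B. 1 - L (w @ [j]))"
  unfolding Ext_self_bounding_walks[OF assms] by (subst prod.reindex) (auto simp: inj_on_def)

section \<open>Validity and positivity of the independence polynomial\<close>

lemma valid_if_ind_poly_pos:
  fixes G :: "'v::linorder pair_pre_digraph"
  assumes G: "pair_graph G" and p: "\<And>i. i \<in> pverts G \<Longrightarrow> 0 \<le> p i"
    and pos: "\<And>S. S \<subseteq> pverts G \<Longrightarrow> 0 < ind_poly G p S"
  shows "valid p (self_bounding_walks G)"
proof -
  interpret pair_graph G by (rule G)
  have fin: "finite S" if "S \<subseteq> pverts G" for S
    using that pair_finite_verts by (rule finite_subset)
  let ?I = "ind_poly G p"
  \<comment> \<open>In Shearer's measure this is the conditional probability of the event at
    \<open>last w\<close>, given that no event of a non-forbidden vertex occurs.\<close>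
  define L where "L w = (let S = pverts G - (THE B. self_bounding G w B)
    in p (last w) * ?I (S - neighbors G (last w)) / ?I S)" for w
  have L: "L w = p (last w) * ?I (pverts G - B - neighbors G (last w)) / ?I (pverts G - B)"
    if "self_bounding G w B" for w B
  proof -
    have "(THE B. self_bounding G w B) = B"
      using that self_bounding_unique by (intro the_equality) blast+
    then show ?thesis by (simp add: L_def Let_def)
  qed
  have L': "1 - L w = ?I (insert (last w) (pverts G - B)) / ?I (pverts G - B)"
    if w: "self_bounding G w B" for w B
  proof -
    have "last w \<notin> pverts G - B" using self_bounding_props(2)[OF G w] by simp
    then show ?thesis
      using ind_poly_insert[of "pverts G - B" "last w" p] pos[of "pverts G - B"] pair_finite_verts
      by (simp add: L[OF w] field_simps)
  qed
  show ?thesis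
    unfolding valid_def
  proof (intro exI conjI ballI)
    show "L \<in> self_bounding_walks G \<rightarrow> {0..<1}"
    proof
      fix w assume "w \<in> self_bounding_walks G"
      then obtain B where w: "self_bounding G w B" by (auto simp: self_bounding_walks_def)
      have "last w \<in> pverts G" "last w \<in> B" using self_bounding_props[OF G w] by auto
      then have "0 < ?I (insert (last w) (pverts G - B)) / ?I (pverts G - B)"
        by (intro divide_pos_pos pos) auto
      then have "L w < 1" using L'[OF w] by simp
      moreover have "0 \<le> L w"
        unfolding L[OF w] using \<open>last w \<in> pverts G\<close>
        by (intro divide_nonneg_pos mult_nonneg_nonneg p pos less_imp_le[OF pos]) auto
      ultimately show "L w \<in> {0..<1}" by simp
    qed
  next
    fix w assume "w \<in> self_bounding_walks G"
    then obtain B where w: "self_bounding G w B" by (auto simp: self_bounding_walks_def)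
    let ?S = "pverts G - B" and ?A = "neighbors G (last w) - B"
    have A: "?A \<subseteq> pverts G" using neighbors_subset by auto
    have "(\<Prod>j\<in>?A. 1 - L (w @ [j])) = (\<Prod>j\<in>?A. ?I (?S - {k\<in>?A. k > j}) / ?I (?S - {k\<in>?A. k \<ge> j}))"
    proof (rule prod.cong[OF refl])
      fix j assume j: "j \<in> ?A"
      let ?B = "B \<union> {k \<in> neighbors G (last w). k \<ge> j}"
      have "self_bounding G (w @ [j]) ?B" using w j by (auto intro: self_bounding.step)
      from L'[OF this] have "1 - L (w @ [j]) = ?I (insert j (pverts G - ?B)) / ?I (pverts G - ?B)"
        by simp
      \<comment> \<open>The step to \<open>j\<close> forbids \<open>j\<close> and the larger
        neighbours; putting \<open>j\<close> back leaves only the strictly larger ones removed, as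
        in \<open>prod_telescope\<close>.\<close>
      also have "insert j (pverts G - ?B) = ?S - {k\<in>?A. k > j}" using A j by auto
      also have "pverts G - ?B = ?S - {k\<in>?A. k \<ge> j}" by auto
      finally show "1 - L (w @ [j]) = ?I (?S - {k\<in>?A. k > j}) / ?I (?S - {k\<in>?A. k \<ge> j})" .
    qed
    also have "\<dots> = ?I ?S / ?I (?S - ?A)"
      using fin[OF A] by (intro prod_telescope less_imp_neq[OF pos, symmetric]) auto
    finally have "(\<Prod>y\<in>Ext (self_bounding_walks G) w. 1 - L y) = ?I ?S / ?I (?S - ?A)"
      by (simp add: prod_Ext_self_bounding_walks[OF G w])
    \<comment> \<open>Neighbours in \<open>B\<close> are already missing from
      \<open>?S\<close>.\<close>
    moreover have "?S - neighbors G (last w) = ?S - ?A" by auto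
    moreover have "?I ?S \<noteq> 0" "?I (?S - ?A) \<noteq> 0"
      by (auto intro!: less_imp_neq[OF pos, symmetric])
    ultimately show "p (last w) \<le> L w * (\<Prod>y\<in>Ext (self_bounding_walks G) w. 1 - L y)"
      by (simp add: L[OF w])
  qed
qed

text \<open>For an arbitrary \<open>L\<close> the ratios of \<open>ind_poly\<close> are only bounded
  below by \<open>1 - L w\<close>. Positivity and this bound are proved together by induction on
  \<open>S\<close>; since all subsets must be covered, the bound is claimed whenever
  \<open>S - {last w}\<close> avoids the forbidden set, not only for the full complement.\<close>

lemma ind_poly_pos_if_valid:
  fixes G :: "'v::linorder pair_pre_digraph"
  assumes G: "pair_graph G" and v: "valid p (self_bounding_walks G)"
    and "S \<subseteq> pverts G"
  shows "0 < ind_poly G p S"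
proof -
  interpret pair_graph G by (rule G)
  let ?I = "ind_poly G p"
  obtain L where L: "L \<in> self_bounding_walks G \<rightarrow> {0..<1}"
    and le: "\<And>w. w \<in> self_bounding_walks G \<Longrightarrow>
      p (last w) \<le> L w * (\<Prod>y\<in>Ext (self_bounding_walks G) w. 1 - L y)"
    using v unfolding valid_def by blast
  have sbw: "w \<in> self_bounding_walks G" if "self_bounding G w B" for w B
    using that self_bounding_props(1)[OF G that] by (auto simp: self_bounding_walks_def)
  have L01: "0 \<le> L w" "L w < 1" if "self_bounding G w B" for w B
    using L sbw[OF that] by (auto simp: Pi_iff)
  have "finite S" using assms(3) pair_finite_verts by (rule finite_subset)
  then have "S \<subseteq> pverts G \<longrightarrow> 0 < ?I S \<and>
    (\<forall>w B. self_bounding G w B \<longrightarrow> last w \<in> S \<longrightarrow> S - {last w} \<subseteq> pverts G - B \<longrightarrow>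
      (1 - L w) * ?I (S - {last w}) \<le> ?I S)"
  proof (induction S rule: finite_psubset_induct)
    case (psubset S)
    show ?case
    proof (intro impI)
      assume S: "S \<subseteq> pverts G"
      have pos: "0 < ?I R" if "R \<subset> S" for R
        using psubset.IH[OF that] that S by auto
      have IH: "(1 - L w) * ?I (R - {last w}) \<le> ?I R"
        if "R \<subset> S" "self_bounding G w B" "last w \<in> R" "R - {last w} \<subseteq> pverts G - B" for R w B
        using psubset.IH[OF that(1)] that S by blast
      have ratio: "(1 - L w) * ?I (S - {last w}) \<le> ?I S"
        if w: "self_bounding G w B" and i: "last w \<in> S" and SB: "S - {last w} \<subseteq> pverts G - B" for w B
      proof -
        define R where "R = S - {last w}"
        let ?C = "neighbors G (last w) - B"
        define A where "A = ?C \<inter> R"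
        have finR: "finite R" using psubset.hyps by (simp add: R_def)
        have R: "R \<subset> S" "last w \<notin> R" "insert (last w) R = S" "R \<subseteq> pverts G - B"
          using i SB by (auto simp: R_def)
        have RA: "R - A = R - neighbors G (last w)" using R(4) by (auto simp: A_def)
        have step: "self_bounding G (w @ [j]) (B \<union> {k \<in> neighbors G (last w). k \<ge> j})" if "j \<in> ?C" for j
          using w that by (auto intro: self_bounding.step)
        have finC: "finite ?C" using finite_subset[OF neighbors_subset pair_finite_verts] by simp
        \<comment> \<open>Extensions leading outside \<open>R\<close> match no factor of the
          telescoping product; their factors are at most 1 and are dropped.\<close>
        have "(\<Prod>j\<in>?C. 1 - L (w @ [j])) = (\<Prod>j\<in>?C - A. 1 - L (w @ [j])) * (\<Prod>j\<in>A. 1 - L (w @ [j]))"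
          by (rule prod.subset_diff) (use finC in \<open>auto simp: A_def\<close>)
        also have "\<dots> \<le> 1 * (\<Prod>j\<in>A. 1 - L (w @ [j]))"
          by (intro mult_right_mono prod_le_1 prod_nonneg)
            (use L01[OF step] in \<open>force simp: A_def\<close>)+
        also have "\<dots> \<le> (\<Prod>j\<in>A. ?I (R - {k\<in>A. k > j}) / ?I (R - {k\<in>A. k \<ge> j}))"
          unfolding mult_1
        proof (rule prod_mono)
          fix j assume j: "j \<in> A"
          then have jC: "j \<in> ?C" and jR: "j \<in> R" by (auto simp: A_def)
          let ?R = "R - {k\<in>A. k > j}"
          have eq: "?R - {j} = R - {k\<in>A. k \<ge> j}" using j by auto
          have "?R \<subset> S" using R(1) by auto
          \<comment> \<open>Since \<open>R\<close> avoids \<open>B\<close>, its neighbours of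
            \<open>last w\<close> all lie in \<open>A\<close>, so removing those from
            \<open>j\<close> upwards removes everything newly forbidden.\<close>
          moreover have "?R - {j} \<subseteq> pverts G - (B \<union> {k \<in> neighbors G (last w). k \<ge> j})"
            unfolding eq using R(4) by (auto simp: A_def)
          ultimately have "(1 - L (w @ [j])) * ?I (?R - {j}) \<le> ?I ?R"
            using IH[OF _ step[OF jC]] jR by simp
          moreover have "0 < ?I (?R - {j})" using R(1) by (intro pos) auto
          ultimately show "0 \<le> 1 - L (w @ [j]) \<and>
              1 - L (w @ [j]) \<le> ?I ?R / ?I (R - {k\<in>A. k \<ge> j})"
            using L01[OF step[OF jC]] by (simp add: eq pos_le_divide_eq)
        qed
        also have "\<dots> = ?I R / ?I (R - A)"
          using R(1) finR
          by (intro prod_telescope less_imp_neq[OF pos, symmetric]) (auto simp: A_def)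
        finally have "L w * (\<Prod>y\<in>Ext (self_bounding_walks G) w. 1 - L y) \<le> L w * (?I R / ?I (R - A))"
          unfolding prod_Ext_self_bounding_walks[OF G w]
          using L01[OF w] by (intro mult_left_mono)
        with le[OF sbw[OF w]] have "p (last w) \<le> L w * (?I R / ?I (R - A))" by linarith
        moreover have "0 < ?I (R - A)" using R(1) by (intro pos) auto
        ultimately have "p (last w) * ?I (R - A) \<le> L w * ?I R" by (simp add: field_simps)
        then show ?thesis
          using ind_poly_insert[OF finR R(2), of p] R(3) RA
          by (simp add: R_def[symmetric] algebra_simps)
      qed
      have "0 < ?I S"
      proof (cases "S = {}")
        case False
        then obtain i where i: "i \<in> S" by auto
        \<comment> \<open>The single-vertex walk forbids only \<open>i\<close>, so its ratio bound
          applies to any \<open>S\<close> containing \<open>i\<close>.\<close>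
        have w: "self_bounding G [i] {i}" using i S by (auto intro: self_bounding.start)
        have "0 < (1 - L [i]) * ?I (S - {i})"
          using L01[OF w] i by (intro mult_pos_pos pos) auto
        also have "\<dots> \<le> ?I S" using ratio[OF w] i S by auto
        finally show ?thesis .
      qed simp
      with ratio show "0 < ?I S \<and>
        (\<forall>w B. self_bounding G w B \<longrightarrow> last w \<in> S \<longrightarrow> S - {last w} \<subseteq> pverts G - B \<longrightarrow>
          (1 - L w) * ?I (S - {last w}) \<le> ?I S)" by blast
    qed
  qed
  then show ?thesis using assms(3) by blast
qed

subsection \<open>Shearer's extremal measure\<close>

text \<open>Independence is stated through avoidance probabilities in product form, free of
  conditioning. The case \<open>J = {}\<close> yields the marginals.\<close>

lemma realizes_pmf:
  fixes m :: "'a pmf"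
  assumes "\<And>i J. i \<in> pverts G \<Longrightarrow> J \<subseteq> pverts G - (neighbors G i \<union> {i}) \<Longrightarrow>
    measure_pmf.prob m {x. \<forall>j\<in>insert i J. x \<notin> F j} =
      (1 - p i) * measure_pmf.prob m {x. \<forall>j\<in>J. x \<notin> F j}"
  shows "realizes (measure_pmf m) F p G"
proof -
  let ?P = "measure_pmf.prob m"
  have inter: "?P {x. x \<in> F i \<and> (\<forall>j\<in>J. x \<notin> F j)} = p i * ?P {x. \<forall>j\<in>J. x \<notin> F j}"
    if "i \<in> pverts G" "J \<subseteq> pverts G - (neighbors G i \<union> {i})" for i J
  proof -
    have "{x. \<forall>j\<in>J. x \<notin> F j} = {x. \<forall>j\<in>insert i J. x \<notin> F j} \<union> {x. x \<in> F i \<and> (\<forall>j\<in>J. x \<notin> F j)}"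
      by auto
    also have "?P \<dots> = ?P {x. \<forall>j\<in>insert i J. x \<notin> F j} + ?P {x. x \<in> F i \<and> (\<forall>j\<in>J. x \<notin> F j)}"
      by (rule measure_pmf.finite_measure_Union) auto
    finally show ?thesis using assms[OF that] by (simp add: algebra_simps)
  qed
  have F: "?P (F i) = p i" if "i \<in> pverts G" for i
    using inter[OF that, of "{}"] by simp
  moreover have "dependency_graph G (measure_pmf m) F"
    unfolding dependency_graph_def by (auto simp: cond_prob_def inter F)
  ultimately show ?thesis
    unfolding realizes_def using measure_pmf.prob_space_axioms by auto
qed

text \<open>For \<open>X = pverts G\<close> the summands are the weights of Shearer's measure.
  Choosing \<open>v\<close> in \<open>U\<close>, the sets without \<open>v\<close> sum to
  \<open>ind_poly G p (X - (U - {v}))\<close>, and those with \<open>v\<close> supply exactly the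
  term that the recurrence subtracts there.\<close>

lemma (in pair_graph) sum_independent_ind_poly:
  assumes "finite X" "U \<subseteq> X"
  shows "(\<Sum>T | T \<subseteq> U \<and> independent G T. (\<Prod>i\<in>T. p i) * ind_poly G p (X - (T \<union> (\<Union>i\<in>T. neighbors G i)))) =
    ind_poly G p (X - U)"
proof -
  have "finite U" using assms by (rule finite_subset[rotated])
  then show ?thesis
    using assms
  proof (induction U arbitrary: X rule: finite_psubset_induct)
    case (psubset U)
    show ?case
    proof (cases "U = {}")
      case True
      have "{T. T = {} \<and> independent G T} = {{}}" by (auto simp: independent_def)
      then show ?thesis using True by simp
    next
      case False
      then obtain v where v: "v \<in> U" by auto
      define R where "R = U - {v}"
      have R: "insert v R = U" "v \<notin> R" "R \<subset> U" "finite R" "R \<subseteq> X" "v \<in> X"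
        using v psubset.hyps psubset.prems by (auto simp: R_def)
      let ?N = "\<lambda>T. T \<union> (\<Union>i\<in>T. neighbors G i)"
      let ?I = "ind_poly G p"
      \<comment> \<open>Sets containing \<open>v\<close> are summed over the graph without
        \<open>v\<close> and its neighbours; hence \<open>X\<close> varies in the induction.\<close>
      define Y where "Y = X - ?N {v}"
      have "(\<Sum>T | T \<subseteq> R - neighbors G v \<and> independent G T. (\<Prod>i\<in>insert v T. p i) * ?I (X - ?N (insert v T))) =
        (\<Sum>T | T \<subseteq> R - neighbors G v \<and> independent G T. p v * ((\<Prod>i\<in>T. p i) * ?I (Y - ?N T)))"
      proof (intro sum.cong refl)
        fix T assume T: "T \<in> {T. T \<subseteq> R - neighbors G v \<and> independent G T}"
        have "X - ?N (insert v T) = Y - ?N T" by (auto simp: Y_def)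
        moreover have "finite T" "v \<notin> T" using T R by (auto intro: finite_subset)
        ultimately show "(\<Prod>i\<in>insert v T. p i) * ?I (X - ?N (insert v T)) = p v * ((\<Prod>i\<in>T. p i) * ?I (Y - ?N T))"
          by simp
      qed
      also have "\<dots> = p v * ?I (Y - (R - neighbors G v))"
        unfolding sum_distrib_left[symmetric]
        using R psubset.prems by (subst psubset.IH) (auto simp: Y_def)
      also have "Y - (R - neighbors G v) = (X - U) - neighbors G v"
        using R by (auto simp: Y_def)
      finally have 2: "(\<Sum>T | T \<subseteq> R - neighbors G v \<and> independent G T. (\<Prod>i\<in>insert v T. p i) * ?I (X - ?N (insert v T))) =
        p v * ?I (X - U - neighbors G v)" .
      have 1: "(\<Sum>T | T \<subseteq> R \<and> independent G T. (\<Prod>i\<in>T. p i) * ?I (X - ?N T)) = ?I (X - R)"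
        using R psubset.prems by (intro psubset.IH) auto
      have "X - R = insert v (X - U)" using R by auto
      then have "?I (X - R) = ?I (X - U) - p v * ?I (X - U - neighbors G v)"
        using ind_poly_insert[of "X - U" v p] v psubset.prems by auto
      with 1 2 show ?thesis
        using sum_independent_insert[OF R(4,2), of "\<lambda>T. (\<Prod>i\<in>T. p i) * ?I (X - ?N T)"] R(1)
        by simp
    qed
  qed
qed

text \<open>A sample point is the set of events that occur. Only independent sets get weight, so
  adjacent events never occur together.\<close>

lemma (in pair_graph) shearer_measure:
  assumes p: "\<And>i. i \<in> pverts G \<Longrightarrow> 0 \<le> p i"
    and nonneg: "\<And>S. S \<subseteq> pverts G \<Longrightarrow> 0 \<le> ind_poly G p S"
  obtains m :: "'a set pmf"
  where "\<And>S. S \<subseteq> pverts G \<Longrightarrow> measure_pmf.prob m {T. \<forall>j\<in>S. T \<notin> {T. j \<in> T}} = ind_poly G p S"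
proof -
  let ?V = "pverts G"
  let ?g = "\<lambda>T. (\<Prod>i\<in>T. p i) * ind_poly G p (?V - (T \<union> (\<Union>i\<in>T. neighbors G i)))"
  define w where "w T = (if T \<subseteq> ?V \<and> independent G T then ?g T else 0)" for T
  have w0: "0 \<le> w T" for T
    using p by (auto simp: w_def intro!: mult_nonneg_nonneg prod_nonneg nonneg)
  have sum_w: "(\<Sum>T\<in>Pow (?V - S). w T) = ind_poly G p S" if "S \<subseteq> ?V" for S
  proof -
    have "(\<Sum>T\<in>Pow (?V - S). w T) = (\<Sum>T | T \<subseteq> ?V - S \<and> independent G T. ?g T)"
      using pair_finite_verts by (intro sum.mono_neutral_cong_right) (auto simp: w_def)
    also have "\<dots> = ind_poly G p (?V - (?V - S))"
      using pair_finite_verts by (intro sum_independent_ind_poly) auto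
    also have "?V - (?V - S) = S" using that by auto
    finally show ?thesis .
  qed
  have "(\<integral>\<^sup>+T. ennreal (w T) \<partial>count_space UNIV) = (\<Sum>T\<in>Pow ?V. ennreal (w T))"
    using pair_finite_verts
    by (intro nn_integral_count_space'[OF finite_Pow_iff[THEN iffD2]]) (auto simp: w_def)
  \<comment> \<open>Total mass is the case \<open>S = {}\<close>, where \<open>ind_poly\<close> is
    1.\<close>
  also have "\<dots> = 1" using sum_w[of "{}"] w0 by (simp add: sum_ennreal)
  finally have one: "(\<integral>\<^sup>+T. ennreal (w T) \<partial>count_space UNIV) = 1" .
  define m where "m = embed_pmf w"
  have pmf: "pmf m = w" using pmf_embed_pmf[of w, OF w0 one] by (auto simp: m_def)
  have "measure_pmf.prob m {T. \<forall>j\<in>S. T \<notin> {T. j \<in> T}} = ind_poly G p S" if "S \<subseteq> ?V" for S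
  proof -
    have "measure_pmf.prob m {T. \<forall>j\<in>S. T \<notin> {T. j \<in> T}} = measure_pmf.prob m (Pow (?V - S))"
      by (rule measure_prob_cong_0) (auto simp: pmf w_def)
    also have "\<dots> = (\<Sum>T\<in>Pow (?V - S). w T)"
      using pair_finite_verts by (simp add: measure_measure_pmf_finite pmf)
    finally show ?thesis using sum_w[OF that] by simp
  qed
  then show ?thesis by (rule that)
qed

lemma (in pair_graph) shearer_measure_realizes:
  assumes "\<And>S. S \<subseteq> pverts G \<Longrightarrow> measure_pmf.prob m {x. \<forall>j\<in>S. x \<notin> F j} = ind_poly G p S"
  shows "realizes (measure_pmf m) F p G"
proof (rule realizes_pmf)
  fix i J assume i: "i \<in> pverts G" and J: "J \<subseteq> pverts G - (neighbors G i \<union> {i})"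
  have "ind_poly G p (insert i J) = (1 - p i) * ind_poly G p J"
  proof -
    have "J - neighbors G i = J" using J by auto
    moreover have "finite J" "i \<notin> J" using J pair_finite_verts by (auto intro: finite_subset)
    ultimately show ?thesis using ind_poly_insert[of J i p] by (simp add: algebra_simps)
  qed
  then show "measure_pmf.prob m {x. \<forall>j\<in>insert i J. x \<notin> F j} =
      (1 - p i) * measure_pmf.prob m {x. \<forall>j\<in>J. x \<notin> F j}"
    using i J by (subst (1 2) assms) auto
qed

section \<open>Enlarging events by independent coins\<close>

lemma measure_pair_pmf_Times:
  "measure_pmf.prob (pair_pmf M N) (A \<times> B) = measure_pmf.prob M A * measure_pmf.prob N B"
proof -
  \<comment> \<open>Passing to the supports makes both factors countable, as
    \<open>measure_pmf_prob_product\<close> requires.\<close>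
  have "measure_pmf.prob (pair_pmf M N) (A \<times> B) =
    measure_pmf.prob (pair_pmf M N) ((A \<inter> set_pmf M) \<times> (B \<inter> set_pmf N))"
    by (subst measure_Int_set_pmf[symmetric]) (simp add: Times_Int_Times)
  then show ?thesis by (simp add: measure_pmf_prob_product measure_Int_set_pmf)
qed

text \<open>Each event is united with its own independent coin. This multiplies the avoidance
  probability of \<open>S\<close> by a product over \<open>S\<close>, which preserves the dependency
  structure and cannot increase the probability of avoiding everything.\<close>

lemma (in pair_graph) realizes_enlarged:
  fixes m :: "'b pmf"
  assumes Q: "\<And>S. S \<subseteq> pverts G \<Longrightarrow> measure_pmf.prob m {x. \<forall>j\<in>S. x \<notin> F j} = ind_poly G q S"
    and qp: "\<And>i. i \<in> pverts G \<Longrightarrow> q i \<le> p i" and p1: "\<And>i. i \<in> pverts G \<Longrightarrow> p i < 1"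
  obtains M :: "('b \<times> ('a \<Rightarrow> bool)) measure" and H where "realizes M H p G"
    "\<P>(x in M. \<forall>i\<in>pverts G. x \<notin> H i) \<le> ind_poly G q (pverts G)"
proof -
  let ?V = "pverts G"
  \<comment> \<open>Solves \<open>(1 - q i) * (1 - a i) = 1 - p i\<close>.\<close>
  define a where "a i = (p i - q i) / (1 - q i)" for i
  define N where "N = Pi_pmf ?V False (\<lambda>i. bernoulli_pmf (a i))"
  define H where "H i = {(x, f). x \<in> F i \<or> f i}" for i
  let ?P = "measure_pmf.prob (pair_pmf m N)"
  have a: "0 \<le> a i" "a i \<le> 1" "(1 - q i) * (1 - a i) = 1 - p i" if "i \<in> ?V" for i
    using qp[OF that] p1[OF that] by (auto simp: a_def field_simps)
  have N: "measure_pmf.prob N {f. \<forall>j\<in>S. \<not> f j} = (\<Prod>i\<in>S. 1 - a i)" if "S \<subseteq> ?V" for S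
  proof -
    have "{f. \<forall>j\<in>S. \<not> f j} = Pi ?V (\<lambda>i. if i \<in> S then {False} else UNIV)"
      using that unfolding Pi_iff by (force split: if_splits)
    then have "measure_pmf.prob N {f. \<forall>j\<in>S. \<not> f j} =
      (\<Prod>i\<in>?V. measure_pmf.prob (bernoulli_pmf (a i)) (if i \<in> S then {False} else UNIV))"
      unfolding N_def by (simp add: measure_Pi_pmf_Pi pair_finite_verts)
    also have "\<dots> = (\<Prod>i\<in>?V. if i \<in> S then 1 - a i else 1)"
      by (intro prod.cong) (auto simp: measure_pmf_single a)
    also have "\<dots> = (\<Prod>i\<in>S. 1 - a i)"
      using that pair_finite_verts by (intro prod.mono_neutral_cong_right) auto
    finally show ?thesis .
  qed
  have PH: "?P {x. \<forall>j\<in>S. x \<notin> H j} = ind_poly G q S * (\<Prod>i\<in>S. 1 - a i)" if "S \<subseteq> ?V" for S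
  proof -
    have "{x. \<forall>j\<in>S. x \<notin> H j} = {x. \<forall>j\<in>S. x \<notin> F j} \<times> {f. \<forall>j\<in>S. \<not> f j}"
      by (auto simp: H_def)
    then show ?thesis by (simp add: measure_pair_pmf_Times Q N that)
  qed
  have "realizes (measure_pmf (pair_pmf m N)) H p G"
  proof (rule realizes_pmf)
    fix i J assume i: "i \<in> ?V" and J: "J \<subseteq> ?V - (neighbors G i \<union> {i})"
    have "J - neighbors G i = J" using J by auto
    moreover have J': "finite J" "i \<notin> J" "J \<subseteq> ?V" "insert i J \<subseteq> ?V"
      using i J pair_finite_verts by (auto intro: finite_subset)
    ultimately have "ind_poly G q (insert i J) = (1 - q i) * ind_poly G q J"
      using ind_poly_insert[of J i q] by (simp add: algebra_simps)
    moreover have "(\<Prod>i\<in>insert i J. 1 - a i) = (1 - a i) * (\<Prod>i\<in>J. 1 - a i)"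
      using J' by simp
    ultimately have "?P {x. \<forall>j\<in>insert i J. x \<notin> H j} =
        ((1 - q i) * (1 - a i)) * (ind_poly G q J * (\<Prod>i\<in>J. 1 - a i))"
      unfolding PH[OF J'(4)] by (simp only: ac_simps)
    then show "?P {x. \<forall>j\<in>insert i J. x \<notin> H j} = (1 - p i) * ?P {x. \<forall>j\<in>J. x \<notin> H j}"
      by (simp only: a(3)[OF i] PH[OF J'(3)])
  qed
  moreover have "0 \<le> ind_poly G q ?V" by (simp flip: Q)
  then have "ind_poly G q ?V * (\<Prod>i\<in>?V. 1 - a i) \<le> ind_poly G q ?V * 1"
    using a by (intro mult_left_mono prod_le_1) auto
  ultimately show ?thesis using PH[of ?V] by (intro that[of "measure_pmf (pair_pmf m N)" H]) auto
qed

section \<open>Scaling to the boundary\<close>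

lemma continuous_on_Min:
  fixes f :: "'i \<Rightarrow> 'a::topological_space \<Rightarrow> 'b::linorder_topology"
  assumes "finite I" "I \<noteq> {}" "\<And>i. i \<in> I \<Longrightarrow> continuous_on A (f i)"
  shows "continuous_on A (\<lambda>x. Min ((\<lambda>i. f i x) ` I))"
  using assms
proof (induction I rule: finite_ne_induct)
  case (insert i I)
  then have "(\<lambda>x. Min ((\<lambda>i. f i x) ` insert i I)) = (\<lambda>x. min (f i x) (Min ((\<lambda>i. f i x) ` I)))"
    by auto
  with insert show ?case by (auto intro!: continuous_on_min)
qed auto

text \<open>The minimum of \<open>ind_poly\<close> over all vertex subsets is continuous in
  \<open>t\<close>, is 1 at \<open>t = 0\<close> and at most 0 at \<open>t = 1\<close>. Where it
  vanishes, some subset attains 0 and none is negative.\<close>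

lemma (in pair_graph) exists_critical_scaling:
  assumes "S \<subseteq> pverts G" "ind_poly G p S \<le> 0"
  obtains t R where "0 \<le> t" "t \<le> 1" "R \<subseteq> pverts G" "ind_poly G (\<lambda>i. t * p i) R = 0"
    "\<And>U. U \<subseteq> pverts G \<Longrightarrow> 0 \<le> ind_poly G (\<lambda>i. t * p i) U"
proof -
  let ?I = "\<lambda>U t. ind_poly G (\<lambda>i. t * p i) U"
  let ?V = "Pow (pverts G)"
  let ?M = "\<lambda>t. Min ((\<lambda>U. ?I U t) ` ?V)"
  have fin: "finite ((\<lambda>U. ?I U t) ` ?V)" "(\<lambda>U. ?I U t) ` ?V \<noteq> {}" for t
    using pair_finite_verts by auto
  have "?M 1 \<le> 0" using assms by (intro order.trans[OF Min_le[OF fin(1)]]) auto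
  moreover have "0 \<le> ?M 0"
  proof -
    have "?I U 0 = 1" if "U \<subseteq> pverts G" for U
    proof -
      have "finite U" using that pair_finite_verts by (rule finite_subset)
      then show ?thesis
        by (induction U rule: finite_induct) (simp_all add: ind_poly_insert)
    qed
    then show ?thesis using fin by (auto simp: Min_ge_iff)
  qed
  moreover have "continuous_on {0..1} ?M"
    using pair_finite_verts
    by (intro continuous_on_Min) (auto simp: ind_poly_def intro!: continuous_intros)
  ultimately obtain t where t: "0 \<le> t" "t \<le> 1" "?M t = 0"
    using IVT2'[of ?M 1 0 0] by auto
  have "0 \<in> (\<lambda>U. ?I U t) ` ?V" using Min_in[OF fin, of t] t(3) by simp
  then obtain R where "R \<subseteq> pverts G" "?I R t = 0" by auto
  moreover have "0 \<le> ?I U t" if "U \<subseteq> pverts G" for U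
    using Min_le[OF fin(1), of "?I U t" t] t(3) that by auto
  ultimately show ?thesis using t(1,2) that by blast
qed

section \<open>Shearer's theorem and the equivalence with validity\<close>

theorem (in pair_graph) shearer:
  assumes p: "p \<in> pverts G \<rightarrow> {0..<1}"
  shows "0 < avoid p G \<longleftrightarrow> (\<forall>S\<subseteq>pverts G. 0 < ind_poly G p S)"
proof
  let ?V = "pverts G"
  have p01: "0 \<le> p i" "p i < 1" if "i \<in> ?V" for i using p that by (auto simp: Pi_iff)
  show "\<forall>S\<subseteq>?V. 0 < ind_poly G p S" if avoid: "0 < avoid p G"
  proof (rule ccontr)
    assume "\<not> (\<forall>S\<subseteq>?V. 0 < ind_poly G p S)"
    then obtain S where "S \<subseteq> ?V" "ind_poly G p S \<le> 0" by (auto simp: not_less)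
    then obtain t R where t: "0 \<le> t" "t \<le> 1" and R: "R \<subseteq> ?V" "ind_poly G (\<lambda>i. t * p i) R = 0"
      and nonneg: "\<And>U. U \<subseteq> ?V \<Longrightarrow> 0 \<le> ind_poly G (\<lambda>i. t * p i) U"
      using exists_critical_scaling by metis
    have q: "0 \<le> t * p i" "t * p i \<le> p i" if "i \<in> ?V" for i
      using t p01(1)[OF that] by (auto intro: mult_left_le_one_le)
    obtain m :: "'a set pmf" where m: "\<And>S. S \<subseteq> ?V \<Longrightarrow>
        measure_pmf.prob m {T. \<forall>j\<in>S. T \<notin> {T. j \<in> T}} = ind_poly G (\<lambda>i. t * p i) S"
      using shearer_measure[of "\<lambda>i. t * p i"] q(1) nonneg by blast
    obtain M :: "('a set \<times> ('a \<Rightarrow> bool)) measure" and H where "realizes M H p G"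
      and "\<P>(x in M. \<forall>i\<in>?V. x \<notin> H i) \<le> ind_poly G (\<lambda>i. t * p i) ?V"
      using realizes_enlarged[OF m, of p] q(2) p01(2) by blast
    moreover have "ind_poly G (\<lambda>i. t * p i) ?V \<le> ind_poly G (\<lambda>i. t * p i) R"
      using pair_finite_verts R(1) q(1) nonneg by (intro ind_poly_antimono)
    \<comment> \<open>The measure lives on another sample space; \<open>avoid_le\<close> transfers
      its avoidance probability.\<close>
    ultimately have "avoid p G \<le> 0"
      using avoid_le[OF pair_finite_verts, of M H p] R(2) by linarith
    then show False using avoid by simp
  qed
  show "0 < avoid p G" if "\<forall>S\<subseteq>?V. 0 < ind_poly G p S"
  proof -
    have pos: "0 < ind_poly G p S" if "S \<subseteq> ?V" for S using that \<open>\<forall>S\<subseteq>?V. _\<close> by blast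
    \<comment> \<open>Shearer's measure shows that the infimum ranges over a nonempty set, as
      \<open>cInf_greatest\<close> requires.\<close>
    obtain m :: "'a set pmf" where "\<And>S. S \<subseteq> ?V \<Longrightarrow>
        measure_pmf.prob m {T. \<forall>j\<in>S. T \<notin> {T. j \<in> T}} = ind_poly G p S"
      using shearer_measure[of p] p01(1) less_imp_le[OF pos] by blast
    from shearer_measure_realizes[OF this]
    have "realizes (measure_pmf m) (\<lambda>j. {T. j \<in> T}) p G" .
    then have "ind_poly G p ?V \<le> avoid p G"
      unfolding avoid_def
      by (intro cInf_greatest) (use shearer_lower_bound[OF _ p01(1) pos] in blast)+
    then show ?thesis using pos[of ?V] by simp
  qed
qed

theorem theorem1:
  fixes n :: nat and G :: "nat pair_pre_digraph" and p :: "nat \<Rightarrow> real"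
  assumes "pair_graph G" and "pverts G = {1..n}"
    and "p \<in> {1..n} \<rightarrow> {0..<1}"
  shows "p \<in> avoid_region G \<longleftrightarrow> valid p (self_bounding_walks G)"
proof -
  have p: "p \<in> pverts G \<rightarrow> {0..<1}" using assms(2,3) by simp
  then have "p \<in> avoid_region G \<longleftrightarrow> (\<forall>S\<subseteq>pverts G. 0 < ind_poly G p S)"
    using pair_graph.shearer[OF assms(1) p] by (auto simp: avoid_region_def)
  also have "\<dots> \<longleftrightarrow> valid p (self_bounding_walks G)"
  proof
    show "valid p (self_bounding_walks G)" if "\<forall>S\<subseteq>pverts G. 0 < ind_poly G p S"
      using that p by (intro valid_if_ind_poly_pos[OF assms(1)]) (auto simp: Pi_iff)
    show "\<forall>S\<subseteq>pverts G. 0 < ind_poly G p S" if "valid p (self_bounding_walks G)"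
      using ind_poly_pos_if_valid[OF assms(1) that] by blast
  qed
  finally show ?thesis .
qed

end
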